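(* Let $L$ be a set with binary operations $\wedge,\vee$ and a unary operation ${}^{\triangle}$. Then $(L,\wedge,\vee,{}^{\triangle})$ is a Boolean algebra (i.e. $(L,\wedge,\vee)$ is a bounded distributive lattice, with least element $0$ and greatest element $1$, and $x^{\triangle}$ is the complement of $x$ for every $x$) if and only if $(L,\wedge,\vee)$ is a non-empty lattice in which \[(x\wedge y)\vee(x\wedge y^{\triangle})=(x\vee y)\wedge(x\vee y^{\triangle})\quad\text{for all }x,y\in L.\] *)

theory Defs
  imports Main
begin

locale lattice_on =
  fixes L :: "'a set"
    and meet :: "'a \<Rightarrow> 'a \<Rightarrow> 'a" (infixl "\<sqinter>" 70)
    and join :: "'a \<Rightarrow> 'a \<Rightarrow> 'a" (infixl "\<squnion>" 65)
  assumes meet_closed: "\<lbrakk>x \<in> L; y \<in> L\<rbrakk> \<Longrightarrow> x \<sqinter> y \<in> L"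
    and join_closed: "\<lbrakk>x \<in> L; y \<in> L\<rbrakk> \<Longrightarrow> x \<squnion> y \<in> L"
    and meet_comm: "\<lbrakk>x \<in> L; y \<in> L\<rbrakk> \<Longrightarrow> x \<sqinter> y = y \<sqinter> x"
    and join_comm: "\<lbrakk>x \<in> L; y \<in> L\<rbrakk> \<Longrightarrow> x \<squnion> y = y \<squnion> x"
    and meet_assoc: "\<lbrakk>x \<in> L; y \<in> L; z \<in> L\<rbrakk> \<Longrightarrow> (x \<sqinter> y) \<sqinter> z = x \<sqinter> (y \<sqinter> z)"
    and join_assoc: "\<lbrakk>x \<in> L; y \<in> L; z \<in> L\<rbrakk> \<Longrightarrow> (x \<squnion> y) \<squnion> z = x \<squnion> (y \<squnion> z)"
    and meet_join_absorb: "\<lbrakk>x \<in> L; y \<in> L\<rbrakk> \<Longrightarrow> x \<sqinter> (x \<squnion> y) = x"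
    and join_meet_absorb: "\<lbrakk>x \<in> L; y \<in> L\<rbrakk> \<Longrightarrow> x \<squnion> (x \<sqinter> y) = x"
begin

definition le :: "'a \<Rightarrow> 'a \<Rightarrow> bool" (infix "\<sqsubseteq>" 50)
  where "x \<sqsubseteq> y \<longleftrightarrow> x \<sqinter> y = x"

end

locale distrib_lattice_on = lattice_on +
  assumes meet_join_distrib:
    "\<lbrakk>x \<in> L; y \<in> L; z \<in> L\<rbrakk> \<Longrightarrow> x \<sqinter> (y \<squnion> z) = (x \<sqinter> y) \<squnion> (x \<sqinter> z)"

(* zero = one is allowed, so the one-element lattice is included. *)
locale bounded_distrib_lattice_on = distrib_lattice_on +
  fixes zero :: 'a (\<open>\<zero>\<close>) and one :: 'a (\<open>\<one>\<close>)
  assumes zero_closed: "\<zero> \<in> L"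
    and one_closed: "\<one> \<in> L"
    and zero_least: "x \<in> L \<Longrightarrow> \<zero> \<sqsubseteq> x"
    and one_greatest: "x \<in> L \<Longrightarrow> x \<sqsubseteq> \<one>"

definition boolean_algebra_on ::
  "'a set \<Rightarrow> ('a \<Rightarrow> 'a \<Rightarrow> 'a) \<Rightarrow> ('a \<Rightarrow> 'a \<Rightarrow> 'a) \<Rightarrow> ('a \<Rightarrow> 'a) \<Rightarrow> bool"
  where "boolean_algebra_on L meet join c \<longleftrightarrow>
    (\<exists>zero one. bounded_distrib_lattice_on L meet join zero one \<and>
      (\<forall>x\<in>L. c x \<in> L \<and> meet x (c x) = zero \<and> join x (c x) = one))"

(* Agreement with the type classes of Main when the carrier is a whole type. *)

lemma lattice_on_UNIV:
  "lattice_on (UNIV :: 'a::lattice set) inf sup"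
  by unfold_locales (auto simp: ac_simps)

lemma lattice_on_UNIV_imp_class:
  assumes "lattice_on UNIV meet join"
  shows "class.lattice meet (lattice_on.le meet) (\<lambda>x y. lattice_on.le meet x y \<and> x \<noteq> y) join"
proof -
  interpret lattice_on UNIV meet join by fact
  note [simp] = le_def[abs_def]
  have idem: "meet x x = x" for x
    by (metis UNIV_I join_meet_absorb meet_join_absorb)
  have le_join: "meet x y = x \<longleftrightarrow> join x y = y" for x y
    by (metis UNIV_I join_meet_absorb meet_join_absorb meet_comm join_comm)
  show ?thesis
  proof
    show "lattice_on.le meet (join y z) x"
      if "lattice_on.le meet y x" "lattice_on.le meet z x" for x y z
      using that by (simp add: le_join join_assoc)
  qed (simp_all add: idem, (metis UNIV_I idem meet_comm meet_assoc meet_join_absorb join_comm)+)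
qed

lemma boolean_algebra_on_UNIV:
  "boolean_algebra_on (UNIV :: 'a::boolean_algebra set) inf sup uminus"
proof -
  interpret lattice_on "UNIV :: 'a set" inf sup by (rule lattice_on_UNIV)
  have "bounded_distrib_lattice_on (UNIV :: 'a set) inf sup bot top"
    by unfold_locales (auto simp: inf_sup_distrib1 le_def)
  then show ?thesis
    unfolding boolean_algebra_on_def by (intro exI[of _ bot] exI[of _ top]) auto
qed

end

theory Submission
  imports Defs
begin

text \<open>
  In any lattice \<open>(x \<sqinter> y) \<squnion> (x \<sqinter> z) \<sqsubseteq> x \<sqsubseteq> (x \<squnion> y) \<sqinter> (x \<squnion> z)\<close>, so the identity makes all three
  equal for \<open>z = tri y\<close>. Taking \<open>x\<close> above \<open>y \<squnion> z\<close> gives \<open>x = y \<squnion> z\<close>, so \<open>y \<squnion> z\<close> is a maximal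
  and hence the greatest element; dually \<open>y \<sqinter> z\<close> is the least one. Moreover,
  \<open>x \<mapsto> (x \<sqinter> y, x \<sqinter> z)\<close> splits the lattice as the product of the ideals below \<open>y\<close> and \<open>z\<close>, so
  meeting with \<open>y\<close> is a projection and preserves joins. As \<open>y\<close> is arbitrary, the lattice is
  distributive.
\<close>

context lattice_on
begin

text \<open>Makes facts proved in this context available with meet and join exchanged.\<close>

lemma dual_lattice_on: "lattice_on L (\<squnion>) (\<sqinter>)"
  by unfold_locales
    (assumption | rule meet_closed join_closed meet_comm join_comm meet_assoc join_assoc
      meet_join_absorb join_meet_absorb)+

lemma join_idem: "x \<in> L \<Longrightarrow> x \<squnion> x = x"
  by (metis join_closed join_meet_absorb meet_join_absorb)

lemma join_eq_imp_meet_eq: "\<lbrakk>x \<in> L; y \<in> L; x \<squnion> y = y\<rbrakk> \<Longrightarrow> x \<sqinter> y = x"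
  by (metis meet_join_absorb)

lemma join_meets_absorb:
  assumes "x \<in> L" "y \<in> L" "z \<in> L"
  shows "(x \<sqinter> y) \<squnion> (x \<sqinter> z) \<squnion> x = x"
  using assms by (metis join_assoc join_comm join_meet_absorb meet_closed)

lemma meet_joins_absorb:
  assumes "x \<in> L" "y \<in> L" "z \<in> L"
  shows "(x \<squnion> y) \<sqinter> (x \<squnion> z) \<sqinter> x = x"
  using lattice_on.join_meets_absorb[OF dual_lattice_on assms] .

lemma join_meets_eq_self:
  assumes "x \<in> L" "y \<in> L" "z \<in> L"
    and "(x \<sqinter> y) \<squnion> (x \<sqinter> z) = (x \<squnion> y) \<sqinter> (x \<squnion> z)"
  shows "(x \<sqinter> y) \<squnion> (x \<sqinter> z) = x"
  using assms by (metis join_closed join_eq_imp_meet_eq join_meets_absorb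
      meet_closed meet_joins_absorb)

lemma split_imp_greatest:
  assumes y: "y \<in> L" and z: "z \<in> L" and x: "x \<in> L"
    and split: "\<And>x. x \<in> L \<Longrightarrow> (x \<sqinter> y) \<squnion> (x \<sqinter> z) = x"
  shows "x \<sqinter> (y \<squnion> z) = x"
proof -
  \<comment> \<open>\<open>?t\<close> lies above both \<open>y\<close> and \<open>z\<close>, so its
    two components in \<open>split\<close> are \<open>y\<close> and \<open>z\<close> themselves.
    Hence \<open>?t\<close> is \<open>y \<squnion> z\<close>, which puts \<open>x\<close> below
    \<open>y \<squnion> z\<close>.\<close>
  let ?t = "x \<squnion> (y \<squnion> z)"
  have t: "?t \<in> L" by (simp add: x y z join_closed)
  have "y \<squnion> ?t = ?t" "z \<squnion> ?t = ?t"
    using x y z by (metis join_assoc join_closed join_comm join_idem)+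
  then have "?t \<sqinter> y = y" "?t \<sqinter> z = z"
    using t y z by (metis join_eq_imp_meet_eq meet_comm)+
  then have "?t = y \<squnion> z" using split[OF t] by simp
  then show ?thesis
    using x y z by (metis join_closed meet_join_absorb)
qed

lemma split_imp_meet_join_distrib:
  assumes y: "y \<in> L" and z: "z \<in> L" and u: "u \<in> L" and v: "v \<in> L"
    and split: "\<And>x. x \<in> L \<Longrightarrow> (x \<sqinter> y) \<squnion> (x \<sqinter> z) = x"
    and dual_split: "\<And>x. x \<in> L \<Longrightarrow> (x \<squnion> y) \<sqinter> (x \<squnion> z) = x"
  shows "y \<sqinter> (u \<squnion> v) = (y \<sqinter> u) \<squnion> (y \<sqinter> v)"
proof -
  \<comment> \<open>\<open>b\<close> and \<open>c\<close> are to be the components of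
    \<open>u \<squnion> v\<close> below \<open>y\<close> and \<open>z\<close>; the goal becomes
    \<open>y \<sqinter> (b \<squnion> c) = b\<close>.\<close>
  define b where "b = (y \<sqinter> u) \<squnion> (y \<sqinter> v)"
  define c where "c = (z \<sqinter> u) \<squnion> (z \<sqinter> v)"
  have b: "b \<in> L" and c: "c \<in> L"
    by (simp_all add: b_def c_def y z u v meet_closed join_closed)
  \<comment> \<open>Regrouped by \<open>u\<close> and \<open>v\<close>, the four meets are the
    splittings of \<open>u\<close> and of \<open>v\<close>.\<close>
  have "b \<squnion> c = ((u \<sqinter> y) \<squnion> (u \<sqinter> z)) \<squnion> ((v \<sqinter> y) \<squnion> (v \<sqinter> z))"
    unfolding b_def c_def using y z u v
    by (smt (verit) join_assoc join_closed join_comm meet_closed meet_comm)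
  then have uv: "u \<squnion> v = b \<squnion> c" by (simp add: split u v)
  have "b \<squnion> y = y" "c \<squnion> z = z"
    unfolding b_def c_def using y z u v by (simp_all add: join_meets_absorb)
  \<comment> \<open>Since \<open>b\<close> is below \<open>y\<close>, \<open>dual_split\<close> at
    \<open>b\<close> reads \<open>y \<sqinter> (b \<squnion> z) = b\<close>. Since \<open>c\<close>
    is below \<open>z\<close>, \<open>b \<squnion> c\<close> is below
    \<open>b \<squnion> z\<close>.\<close>
  then have b_eq: "y \<sqinter> (b \<squnion> z) = b" and "b \<squnion> c \<squnion> (b \<squnion> z) = b \<squnion> z"
    using b c z dual_split[OF b] by (simp, metis join_assoc join_closed join_comm join_idem)
  then have "(b \<squnion> z) \<sqinter> (b \<squnion> c) = b \<squnion> c"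
    using b c z by (metis join_closed join_eq_imp_meet_eq meet_comm)
  \<comment> \<open>Insert the larger factor \<open>b \<squnion> z\<close> before
    \<open>b \<squnion> c\<close>, then contract it with \<open>y\<close> by
    \<open>b_eq\<close>.\<close>
  then have "y \<sqinter> (b \<squnion> c) = b \<sqinter> (b \<squnion> c)"
    using b_eq b c y z by (metis join_closed meet_assoc)
  then show ?thesis
    using uv b c by (simp add: meet_join_absorb b_def)
qed

theorem boolean_algebra_onI:
  assumes "L \<noteq> {}"
    and tri: "\<And>x. x \<in> L \<Longrightarrow> tri x \<in> L"
    and eq: "\<And>x y. \<lbrakk>x \<in> L; y \<in> L\<rbrakk> \<Longrightarrow>
      (x \<sqinter> y) \<squnion> (x \<sqinter> tri y) = (x \<squnion> y) \<sqinter> (x \<squnion> tri y)"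
  shows "boolean_algebra_on L (\<sqinter>) (\<squnion>) tri"
proof -
  have split: "(x \<sqinter> y) \<squnion> (x \<sqinter> tri y) = x" if "x \<in> L" "y \<in> L" for x y
    using that by (intro join_meets_eq_self tri eq)
  then have dual_split: "(x \<squnion> y) \<sqinter> (x \<squnion> tri y) = x" if "x \<in> L" "y \<in> L" for x y
    using that by (simp add: eq)
  have one: "x \<sqinter> (y \<squnion> tri y) = x" if "x \<in> L" "y \<in> L" for x y
    using that by (intro split_imp_greatest tri split)
  have zero: "x \<squnion> (y \<sqinter> tri y) = x" if "x \<in> L" "y \<in> L" for x y
    using that by (intro lattice_on.split_imp_greatest[OF dual_lattice_on] tri dual_split)
  \<comment> \<open>The bounds are built from an arbitrary element, as they do not depend on its
    choice.\<close>
  obtain a where a: "a \<in> L" using assms(1) by blast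
  have "bounded_distrib_lattice_on L (\<sqinter>) (\<squnion>) (a \<sqinter> tri a) (a \<squnion> tri a)"
  proof unfold_locales
    show "x \<sqinter> (y \<squnion> z) = (x \<sqinter> y) \<squnion> (x \<sqinter> z)" if "x \<in> L" "y \<in> L" "z \<in> L" for x y z
      using that by (intro split_imp_meet_join_distrib[where z = "tri x"] tri split dual_split)
    show "(a \<sqinter> tri a) \<sqsubseteq> x" if "x \<in> L" for x
      unfolding le_def using that a tri zero
      by (metis join_comm join_eq_imp_meet_eq meet_closed)
    show "x \<sqsubseteq> (a \<squnion> tri a)" if "x \<in> L" for x
      unfolding le_def using that a one by simp
  qed (simp_all add: a tri meet_closed join_closed)
  \<comment> \<open>Two least elements absorb each other under join, hence coincide; dually for two
    greatest ones.\<close>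
  moreover have "x \<sqinter> tri x = a \<sqinter> tri a" "x \<squnion> tri x = a \<squnion> tri a" if "x \<in> L" for x
    using that a tri zero one by (metis join_comm meet_closed, metis join_closed meet_comm)
  ultimately show ?thesis
    unfolding boolean_algebra_on_def using tri by blast
qed

end

text \<open>Both sides equal \<open>x\<close>. Each is expanded by distributing meet over join, the
  form of distributivity in the locale.\<close>

lemma boolean_algebra_on_imp_eq:
  fixes meet :: "'a \<Rightarrow> 'a \<Rightarrow> 'a" (infixl "\<sqinter>" 70)
    and join :: "'a \<Rightarrow> 'a \<Rightarrow> 'a" (infixl "\<squnion>" 65)
  assumes "boolean_algebra_on L (\<sqinter>) (\<squnion>) tri" "x \<in> L" "y \<in> L"
  shows "(x \<sqinter> y) \<squnion> (x \<sqinter> tri y) = (x \<squnion> y) \<sqinter> (x \<squnion> tri y)"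
proof -
  obtain zero one where "bounded_distrib_lattice_on L (\<sqinter>) (\<squnion>) zero one"
    and tri: "\<And>x. x \<in> L \<Longrightarrow> tri x \<in> L"
      "\<And>x. x \<in> L \<Longrightarrow> x \<sqinter> tri x = zero" "\<And>x. x \<in> L \<Longrightarrow> x \<squnion> tri x = one"
    using assms(1) unfolding boolean_algebra_on_def by blast
  then interpret bounded_distrib_lattice_on L meet join zero one by blast
  let ?s = "x \<squnion> y" and ?y' = "tri y"
  have closed: "?s \<in> L" "?y' \<in> L" "x \<sqinter> ?y' \<in> L" "x \<sqinter> y \<in> L"
    using assms tri by (simp_all add: meet_closed join_closed)
  have "(x \<sqinter> y) \<squnion> (x \<sqinter> ?y') = x \<sqinter> (y \<squnion> ?y')"
    using assms closed by (simp add: meet_join_distrib)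
  also have "\<dots> = x"
    using assms tri one_greatest by (simp add: le_def)
  finally have left: "(x \<sqinter> y) \<squnion> (x \<sqinter> ?y') = x" .
  \<comment> \<open>This is one of the two terms obtained by distributing \<open>?s\<close> over
    \<open>x \<squnion> ?y'\<close>; the part from \<open>y\<close> vanishes because
    \<open>y \<sqinter> ?y'\<close> is \<open>zero\<close>.\<close>
  have "?s \<sqinter> ?y' = (?y' \<sqinter> x) \<squnion> (?y' \<sqinter> y)"
    using assms closed by (simp add: meet_comm[of _ ?y'] meet_join_distrib)
  also have "\<dots> = (x \<sqinter> ?y') \<squnion> zero"
    using assms closed tri by (simp add: meet_comm[of ?y'])
  also have "\<dots> = x \<sqinter> ?y'"
    using zero_least closed zero_closed by (metis le_def join_meet_absorb meet_comm)
  finally have "?s \<sqinter> (x \<squnion> ?y') = (?s \<sqinter> x) \<squnion> (x \<sqinter> ?y')"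
    using assms closed by (simp add: meet_join_distrib)
  also have "\<dots> = x"
    using assms closed by (simp add: meet_comm[of ?s] meet_join_absorb join_meet_absorb)
  finally show ?thesis using left by simp
qed

theorem theorem3:
  fixes L :: "'a set"
    and meet :: "'a \<Rightarrow> 'a \<Rightarrow> 'a" (infixl "\<sqinter>" 70)
    and join :: "'a \<Rightarrow> 'a \<Rightarrow> 'a" (infixl "\<squnion>" 65)
    and tri :: "'a \<Rightarrow> 'a"
  assumes "\<And>x y. \<lbrakk>x \<in> L; y \<in> L\<rbrakk> \<Longrightarrow> x \<sqinter> y \<in> L"
    and "\<And>x y. \<lbrakk>x \<in> L; y \<in> L\<rbrakk> \<Longrightarrow> x \<squnion> y \<in> L"
    and "\<And>x. x \<in> L \<Longrightarrow> tri x \<in> L"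
  shows "boolean_algebra_on L (\<sqinter>) (\<squnion>) tri \<longleftrightarrow>
    L \<noteq> {} \<and> lattice_on L (\<sqinter>) (\<squnion>) \<and>
    (\<forall>x\<in>L. \<forall>y\<in>L.
      (x \<sqinter> y) \<squnion> (x \<sqinter> tri y) = (x \<squnion> y) \<sqinter> (x \<squnion> tri y))"
proof
  assume ba: "boolean_algebra_on L (\<sqinter>) (\<squnion>) tri"
  then obtain zero one where "bounded_distrib_lattice_on L (\<sqinter>) (\<squnion>) zero one"
    unfolding boolean_algebra_on_def by blast
  then interpret bounded_distrib_lattice_on L meet join zero one .
  show "L \<noteq> {} \<and> lattice_on L (\<sqinter>) (\<squnion>) \<and>
    (\<forall>x\<in>L. \<forall>y\<in>L. (x \<sqinter> y) \<squnion> (x \<sqinter> tri y) = (x \<squnion> y) \<sqinter> (x \<squnion> tri y))"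
    using zero_closed lattice_on_axioms boolean_algebra_on_imp_eq[OF ba] by blast
next
  assume "L \<noteq> {} \<and> lattice_on L (\<sqinter>) (\<squnion>) \<and>
    (\<forall>x\<in>L. \<forall>y\<in>L. (x \<sqinter> y) \<squnion> (x \<sqinter> tri y) = (x \<squnion> y) \<sqinter> (x \<squnion> tri y))"
  then show "boolean_algebra_on L (\<sqinter>) (\<squnion>) tri"
    using assms(3) by (intro lattice_on.boolean_algebra_onI) auto
qed

end
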